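(* A finite antilattice $N$ is odd if and only if it is Latin.
   Context: An antilattice $(N,\land,\lor)$ is a nonempty set $N$ with two associative idempotent binary operations satisfying $x\land y\land x=x$ and $x\lor y\lor x=x$ for all $x,y$ (so both reducts are rectangular bands). A subantilattice is a nonempty subset closed under both operations. $N$ is odd if it has no subantilattice with exactly $2$ elements. Generating matrices: for a finite rectangular band $(B,\cdot)$ of order $n$ there are unique $p,q\geq 1$ with $pq=n$ and a $p\times q$ matrix $G$ in which each element of $B$ occurs exactly once, such that $G_{ij}\cdot G_{kl}=G_{il}$ for all $i,j,k,l$; $G$ is unique up to permuting rows and permuting columns. A finite antilattice $N$ is determined by a pair of generating matrices: $M$ (meet matrix, $p\times q$) for $(N,\land)$ and $J$ (join matrix, $r\times s$) for $(N,\lor)$, with $pq=rs=|N|$. When the elements of $N$ are labelled by $1,\dots,pq$, $M$ is in normal form if $M_{ij}=(i-1)q+j$ for all $i,j$; this can always be achieved by relabelling the elements. $N$ is Latin if, after a relabelling for which $M$ is in normal form, and after replacing each element $(i-1)q+j$ by the pair $(i,j)$, the matrices $J_1$ and $J_2$ of first and second components of the entries of $J$ are orthogonal Latin squares. (A Latin square is an $m\times m$ array with $m$ symbols, each occurring exactly once in each row and each column; two Latin squares of the same size are orthogonal if, when superimposed, all the ordered pairs are distinct. A pair of $1\times 1$ squares counts as orthogonal.) *)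

theory Defs
  imports Main
begin

locale rectangular_band =
  fixes B :: "'a set" and mult :: "'a \<Rightarrow> 'a \<Rightarrow> 'a"  (infixl "\<cdot>" 70)
  assumes nonempty: "B \<noteq> {}"
    and closed: "x \<in> B \<Longrightarrow> y \<in> B \<Longrightarrow> x \<cdot> y \<in> B"
    and assoc: "x \<in> B \<Longrightarrow> y \<in> B \<Longrightarrow> z \<in> B \<Longrightarrow> (x \<cdot> y) \<cdot> z = x \<cdot> (y \<cdot> z)"
    and idem: "x \<in> B \<Longrightarrow> x \<cdot> x = x"
    and absorb: "x \<in> B \<Longrightarrow> y \<in> B \<Longrightarrow> x \<cdot> y \<cdot> x = x"

locale antilattice =
  meet: rectangular_band N meet + join: rectangular_band N join
  for N :: "'a set"
    and meet :: "'a \<Rightarrow> 'a \<Rightarrow> 'a"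
    and join :: "'a \<Rightarrow> 'a \<Rightarrow> 'a"

definition subantilattice ::
    "'a set \<Rightarrow> 'a set \<Rightarrow> ('a \<Rightarrow> 'a \<Rightarrow> 'a) \<Rightarrow> ('a \<Rightarrow> 'a \<Rightarrow> 'a) \<Rightarrow> bool" where
  "subantilattice S N meet join \<longleftrightarrow>
     S \<noteq> {} \<and> S \<subseteq> N \<and> (\<forall>x\<in>S. \<forall>y\<in>S. meet x y \<in> S \<and> join x y \<in> S)"

definition odd_antilattice ::
    "'a set \<Rightarrow> ('a \<Rightarrow> 'a \<Rightarrow> 'a) \<Rightarrow> ('a \<Rightarrow> 'a \<Rightarrow> 'a) \<Rightarrow> bool" where
  "odd_antilattice N meet join \<longleftrightarrow>
     \<not> (\<exists>S. subantilattice S N meet join \<and> card S = 2)"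

text \<open>
  A \<open>p \<times> q\<close> matrix is a function of two indices of which only the values on
  \<open>{1..p} \<times> {1..q}\<close> matter.
\<close>

definition generating_matrix ::
    "'a set \<Rightarrow> ('a \<Rightarrow> 'a \<Rightarrow> 'a) \<Rightarrow> nat \<Rightarrow> nat \<Rightarrow> (nat \<Rightarrow> nat \<Rightarrow> 'a) \<Rightarrow> bool" where
  "generating_matrix B f p q G \<longleftrightarrow>
     1 \<le> p \<and> 1 \<le> q \<and>
     bij_betw (\<lambda>(i, j). G i j) ({1..p} \<times> {1..q}) B \<and>
     (\<forall>i\<in>{1..p}. \<forall>j\<in>{1..q}. \<forall>k\<in>{1..p}. \<forall>l\<in>{1..q}. f (G i j) (G k l) = G i l)"

definition normal_form :: "nat \<Rightarrow> nat \<Rightarrow> (nat \<Rightarrow> nat \<Rightarrow> nat) \<Rightarrow> bool" where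
  "normal_form p q M \<longleftrightarrow> (\<forall>i\<in>{1..p}. \<forall>j\<in>{1..q}. M i j = (i - 1) * q + j)"

text \<open>
  \<open>pair_of_label q\<close> inverts \<open>(i, j) \<mapsto> (i - 1) * q + j\<close> for \<open>i \<ge> 1\<close>, \<open>j \<in> {1..q}\<close>.
\<close>

definition pair_of_label :: "nat \<Rightarrow> nat \<Rightarrow> nat \<times> nat" where
  "pair_of_label q x = ((x - 1) div q + 1, (x - 1) mod q + 1)"

lemma pair_of_label_normal_form:
  assumes "1 \<le> i" "j \<in> {1..q}"
  shows "pair_of_label q ((i - 1) * q + j) = (i, j)"
proof -
  obtain a b where "i = Suc a" "j = Suc b" "b < q"
    using assms by (cases i; cases j) auto
  then show ?thesis
    by (simp add: pair_of_label_def)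
qed

definition latin_square :: "nat \<Rightarrow> (nat \<Rightarrow> nat \<Rightarrow> 'b) \<Rightarrow> bool" where
  "latin_square m L \<longleftrightarrow>
     (\<exists>S. finite S \<and> card S = m \<and>
        (\<forall>i\<in>{1..m}. \<forall>j\<in>{1..m}. L i j \<in> S) \<and>
        (\<forall>x\<in>S. \<forall>i\<in>{1..m}. \<exists>!j. j \<in> {1..m} \<and> L i j = x) \<and>
        (\<forall>x\<in>S. \<forall>j\<in>{1..m}. \<exists>!i. i \<in> {1..m} \<and> L i j = x))"

definition orthogonal_latin_squares ::
    "nat \<Rightarrow> (nat \<Rightarrow> nat \<Rightarrow> 'b) \<Rightarrow> (nat \<Rightarrow> nat \<Rightarrow> 'c) \<Rightarrow> bool" where
  "orthogonal_latin_squares m L L' \<longleftrightarrow>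
     latin_square m L \<and> latin_square m L' \<and>
     inj_on (\<lambda>(i, j). (L i j, L' i j)) ({1..m} \<times> {1..m})"

text \<open>
  The map \<open>\<phi>\<close> below is the relabelling of the elements of \<open>N\<close>. That \<open>J\<^sub>1\<close> and
  \<open>J\<^sub>2\<close> are Latin squares includes that the \<open>r \<times> s\<close> matrix \<open>J\<close> is square.
\<close>

definition latin_antilattice ::
    "'a set \<Rightarrow> ('a \<Rightarrow> 'a \<Rightarrow> 'a) \<Rightarrow> ('a \<Rightarrow> 'a \<Rightarrow> 'a) \<Rightarrow> bool" where
  "latin_antilattice N meet join \<longleftrightarrow>
     (\<exists>p q M r s J \<phi>.
        generating_matrix N meet p q M \<and>
        generating_matrix N join r s J \<and>
        bij_betw \<phi> N {1..p * q} \<and>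
        normal_form p q (\<lambda>i j. \<phi> (M i j)) \<and>
        r = s \<and>
        orthogonal_latin_squares r
          (\<lambda>i j. fst (pair_of_label q (\<phi> (J i j))))
          (\<lambda>i j. snd (pair_of_label q (\<phi> (J i j)))))"

end

theory Submission
  imports Defs
begin

text \<open>
  A pair \<open>{x, y}\<close> is closed under the operation of a rectangular band iff \<open>x\<close> and \<open>y\<close> share a row
  or a column of the generating matrix. Hence \<open>N\<close> is odd iff the maps sending a position of \<open>J\<close> to
  the row, respectively column, in \<open>M\<close> of its entry are injective along every row and column of
  \<open>J\<close>. This injectivity gives \<open>r, s \<le> p\<close> and \<open>r, s \<le> q\<close>, and \<open>p q = r s\<close> then forces
  \<open>p = q = r = s\<close>, so that both maps are Latin squares.
\<close>

section \<open>Rectangular bands and their generating matrices\<close>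

context rectangular_band
begin

text \<open>Expanding \<open>z\<close> to \<open>z \<cdot> x \<cdot> z\<close> places a second
  \<open>x\<close> after \<open>y \<cdot> z\<close>, and absorption removes everything between the
  two copies of \<open>x\<close>.\<close>

lemma mult_middle:
  assumes "x \<in> B" "y \<in> B" "z \<in> B"
  shows "x \<cdot> y \<cdot> z = x \<cdot> z"
proof -
  have "x \<cdot> y \<cdot> z = x \<cdot> y \<cdot> (z \<cdot> x \<cdot> z)"
    using assms by (simp add: absorb)
  also have "\<dots> = x \<cdot> (y \<cdot> z) \<cdot> x \<cdot> z"
    using assms by (simp add: assoc closed)
  also have "\<dots> = x \<cdot> z"
    using assms by (simp add: absorb closed)
  finally show ?thesis .
qed

lemma mult_middle':
  assumes "x \<in> B" "y \<in> B" "z \<in> B"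
  shows "x \<cdot> (y \<cdot> z) = x \<cdot> z"
  using assms mult_middle assoc by metis

lemma exists_generating_matrix:
  assumes "finite B"
  shows "\<exists>p q G. generating_matrix B (\<cdot>) p q G"
proof -
  obtain e where e: "e \<in> B"
    using nonempty by blast
  \<comment> \<open>In the matrix to be built, \<open>R\<close> is the column of \<open>e\<close>
    and so contains one element of each row; \<open>C\<close> is the row of \<open>e\<close> and
    represents the columns.\<close>
  define R where "R = (\<lambda>x. x \<cdot> e) ` B"
  define C where "C = (\<lambda>x. e \<cdot> x) ` B"
  have fin: "finite R" "finite C" and ne: "R \<noteq> {}" "C \<noteq> {}"
    using assms nonempty by (auto simp: R_def C_def)
  have R: "a \<in> B" "a \<cdot> e = a" if "a \<in> R" for a
    using that e by (auto simp: R_def closed assoc idem)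
  have C: "b \<in> B" "e \<cdot> b = b" if "b \<in> C" for b
    using that e by (auto simp: C_def closed idem simp flip: assoc)
  obtain g where g: "bij_betw g {1..card R} R"
    using ex_bij_betw_nat_finite_1[OF fin(1)] by blast
  obtain h where h: "bij_betw h {1..card C} C"
    using ex_bij_betw_nat_finite_1[OF fin(2)] by blast
  have "bij_betw (\<lambda>(a, b). a \<cdot> b) (R \<times> C) B"
  proof (rule bij_betw_byWitness[where f' = "\<lambda>x. (x \<cdot> e, e \<cdot> x)"])
    show "\<forall>u\<in>R \<times> C. (\<lambda>x. (x \<cdot> e, e \<cdot> x)) ((\<lambda>(a, b). a \<cdot> b) u) = u"
      using e R C by (auto simp: mult_middle mult_middle')
    show "\<forall>x\<in>B. (\<lambda>(a, b). a \<cdot> b) (x \<cdot> e, e \<cdot> x) = x"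
      using e by (auto simp: mult_middle mult_middle' closed idem)
    show "(\<lambda>(a, b). a \<cdot> b) ` (R \<times> C) \<subseteq> B"
      using R C by (auto simp: closed)
    show "(\<lambda>x. (x \<cdot> e, e \<cdot> x)) ` B \<subseteq> R \<times> C"
      by (auto simp: R_def C_def)
  qed
  with bij_betw_map_prod[OF g h]
  have "bij_betw ((\<lambda>(a, b). a \<cdot> b) \<circ> map_prod g h) ({1..card R} \<times> {1..card C}) B"
    by (rule bij_betw_trans)
  moreover have "(\<lambda>(a, b). a \<cdot> b) \<circ> map_prod g h = (\<lambda>(i, j). g i \<cdot> h j)"
    by auto
  moreover have "g i \<cdot> h j \<cdot> (g k \<cdot> h l) = g i \<cdot> h l"
    if "i \<in> {1..card R}" "k \<in> {1..card R}" "j \<in> {1..card C}" "l \<in> {1..card C}" for i j k l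
  proof -
    have "g i \<in> B" "g k \<in> B" "h j \<in> B" "h l \<in> B"
      using that R(1) C(1) bij_betwE[OF g] bij_betwE[OF h] by blast+
    then show ?thesis
      by (simp add: mult_middle mult_middle' closed)
  qed
  moreover have "1 \<le> card R" "1 \<le> card C"
    using fin ne by (auto simp: Suc_le_eq card_gt_0_iff)
  ultimately have "generating_matrix B (\<cdot>) (card R) (card C) (\<lambda>i j. g i \<cdot> h j)"
    by (simp add: generating_matrix_def)
  then show ?thesis
    by blast
qed

end

lemma generating_matrix_entry:
  assumes "generating_matrix B f p q G" "i \<in> {1..p}" "j \<in> {1..q}"
  shows "G i j \<in> B"
  using assms by (auto simp: generating_matrix_def bij_betw_def)

lemma generating_matrix_obtain:
  assumes "generating_matrix B f p q G" "x \<in> B"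
  obtains i j where "i \<in> {1..p}" "j \<in> {1..q}" "x = G i j"
  using assms by (auto simp: generating_matrix_def bij_betw_def)

lemma generating_matrix_eq_iff:
  assumes "generating_matrix B f p q G"
    and "i \<in> {1..p}" "j \<in> {1..q}" "k \<in> {1..p}" "l \<in> {1..q}"
  shows "G i j = G k l \<longleftrightarrow> i = k \<and> j = l"
proof -
  have "inj_on (\<lambda>(i, j). G i j) ({1..p} \<times> {1..q})"
    using assms(1) by (simp add: generating_matrix_def bij_betw_def)
  from inj_on_eq_iff[OF this, of "(i, j)" "(k, l)"] show ?thesis
    using assms by auto
qed

lemma generating_matrix_card:
  assumes "generating_matrix B f p q G"
  shows "card B = p * q"
  using assms bij_betw_same_card by (fastforce simp: generating_matrix_def)

text \<open>The product is \<open>G i l\<close>, in the row of the first factor and the column of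
  the second. Since entries are distinct, it is the first factor iff \<open>j = l\<close> and the
  second iff \<open>i = k\<close>.\<close>

lemma generating_matrix_pair_closed_iff:
  assumes "generating_matrix B f p q G"
    and "i \<in> {1..p}" "j \<in> {1..q}" "k \<in> {1..p}" "l \<in> {1..q}"
  shows "f (G i j) (G k l) \<in> {G i j, G k l} \<longleftrightarrow> i = k \<or> j = l"
proof -
  have "f (G i j) (G k l) = G i l"
    using assms by (auto simp: generating_matrix_def)
  then show ?thesis
    using assms generating_matrix_eq_iff[OF assms(1)] by auto
qed

section \<open>Oddness as a condition on the join matrix\<close>

lemma odd_antilattice_iff:
  assumes "antilattice N meet join"
  shows "odd_antilattice N meet join \<longleftrightarrow>
    (\<forall>x\<in>N. \<forall>y\<in>N. x \<noteq> y \<longrightarrow>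
      \<not> (meet x y \<in> {x, y} \<and> meet y x \<in> {y, x} \<and> join x y \<in> {x, y} \<and> join y x \<in> {y, x}))"
proof -
  interpret antilattice N meet join
    by (rule assms)
  \<comment> \<open>Idempotence takes care of the products of an element with itself, so only the
    mixed products remain.\<close>
  have "subantilattice {x, y} N meet join \<longleftrightarrow> x \<in> N \<and> y \<in> N \<and>
      meet x y \<in> {x, y} \<and> meet y x \<in> {y, x} \<and> join x y \<in> {x, y} \<and> join y x \<in> {y, x}" for x y
    by (auto simp: subantilattice_def meet.idem join.idem)
  then show ?thesis
    unfolding odd_antilattice_def card_2_iff by blast
qed

text \<open>The uniqueness half of the Latin square property. It names no symbol set and allows
  \<open>r \<noteq> s\<close>, so it can be stated before the join matrix is known to be
  square.\<close>

definition line_injective :: "nat \<Rightarrow> nat \<Rightarrow> (nat \<Rightarrow> nat \<Rightarrow> 'b) \<Rightarrow> bool" where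
  "line_injective r s L \<longleftrightarrow>
     (\<forall>i\<in>{1..r}. inj_on (L i) {1..s}) \<and> (\<forall>j\<in>{1..s}. inj_on (\<lambda>i. L i j) {1..r})"

lemma line_injective_iff:
  "line_injective r s L \<longleftrightarrow>
    (\<forall>i\<in>{1..r}. \<forall>j\<in>{1..s}. \<forall>k\<in>{1..r}. \<forall>l\<in>{1..s}.
      (i, j) \<noteq> (k, l) \<longrightarrow> i = k \<or> j = l \<longrightarrow> L i j \<noteq> L k l)"
  unfolding line_injective_def inj_on_def prod.inject by blast

text \<open>The map \<open>c\<close> locates an element in \<open>M\<close>. A pair is closed under
  the meet iff its members agree in a coordinate of \<open>c\<close>, and under the join iff they
  share a line of \<open>J\<close>; oddness says that no two distinct elements do both.\<close>

lemma odd_antilattice_iff_line_injective: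
  assumes anti: "antilattice N meet join"
    and M: "generating_matrix N meet p q M"
    and J: "generating_matrix N join r s J"
    and c: "\<And>i j. i \<in> {1..p} \<Longrightarrow> j \<in> {1..q} \<Longrightarrow> c (M i j) = (i, j)"
  shows "odd_antilattice N meet join \<longleftrightarrow>
    line_injective r s (\<lambda>i j. fst (c (J i j))) \<and> line_injective r s (\<lambda>i j. snd (c (J i j)))"
proof -
  have meet_iff: "meet x y \<in> {x, y} \<longleftrightarrow> fst (c x) = fst (c y) \<or> snd (c x) = snd (c y)"
    if "x \<in> N" "y \<in> N" for x y
  proof -
    obtain i j where x: "i \<in> {1..p}" "j \<in> {1..q}" "x = M i j"
      using M \<open>x \<in> N\<close> by (rule generating_matrix_obtain)
    obtain k l where y: "k \<in> {1..p}" "l \<in> {1..q}" "y = M k l"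
      using M \<open>y \<in> N\<close> by (rule generating_matrix_obtain)
    show ?thesis
      unfolding x(3) y(3) generating_matrix_pair_closed_iff[OF M x(1,2) y(1,2)]
      using x y by (simp add: c)
  qed
  \<comment> \<open>Closure under the meet, now a shared coordinate, moves negated into the
    conclusion; closure under the join stays as a premise.\<close>
  have "odd_antilattice N meet join \<longleftrightarrow>
    (\<forall>x\<in>N. \<forall>y\<in>N. x \<noteq> y \<longrightarrow> join x y \<in> {x, y} \<longrightarrow> join y x \<in> {y, x} \<longrightarrow>
      fst (c x) \<noteq> fst (c y) \<and> snd (c x) \<noteq> snd (c y))"
    unfolding odd_antilattice_iff[OF anti]
  proof (intro ball_cong refl)
    fix x y
    assume "x \<in> N" "y \<in> N"
    then have *: "meet x y \<in> {x, y} \<longleftrightarrow> fst (c x) = fst (c y) \<or> snd (c x) = snd (c y)"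
      "meet y x \<in> {y, x} \<longleftrightarrow> fst (c y) = fst (c x) \<or> snd (c y) = snd (c x)"
      by (auto simp only: meet_iff)
    show "(x \<noteq> y \<longrightarrow> \<not> (meet x y \<in> {x, y} \<and> meet y x \<in> {y, x} \<and>
          join x y \<in> {x, y} \<and> join y x \<in> {y, x})) \<longleftrightarrow>
        (x \<noteq> y \<longrightarrow> join x y \<in> {x, y} \<longrightarrow> join y x \<in> {y, x} \<longrightarrow>
          fst (c x) \<noteq> fst (c y) \<and> snd (c x) \<noteq> snd (c y))"
      unfolding * by metis
  qed
  also have "\<dots> \<longleftrightarrow>
    (\<forall>i\<in>{1..r}. \<forall>j\<in>{1..s}. \<forall>k\<in>{1..r}. \<forall>l\<in>{1..s}. (i, j) \<noteq> (k, l) \<longrightarrow> i = k \<or> j = l \<longrightarrow>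
      fst (c (J i j)) \<noteq> fst (c (J k l)) \<and> snd (c (J i j)) \<noteq> snd (c (J k l)))"
    (is "?X \<longleftrightarrow> ?Y")
  proof
    assume X: ?X
    show ?Y
    proof (intro ballI impI)
      fix i j k l
      assume ij: "i \<in> {1..r}" "j \<in> {1..s}" and kl: "k \<in> {1..r}" "l \<in> {1..s}"
        and ne: "(i, j) \<noteq> (k, l)" and line: "i = k \<or> j = l"
      have "join (J i j) (J k l) \<in> {J i j, J k l}" "join (J k l) (J i j) \<in> {J k l, J i j}"
        using generating_matrix_pair_closed_iff[OF J ij kl]
          generating_matrix_pair_closed_iff[OF J kl ij] line by auto
      moreover have "J i j \<noteq> J k l"
        using generating_matrix_eq_iff[OF J ij kl] ne by simp
      ultimately show "fst (c (J i j)) \<noteq> fst (c (J k l)) \<and> snd (c (J i j)) \<noteq> snd (c (J k l))"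
        using X generating_matrix_entry[OF J ij] generating_matrix_entry[OF J kl] by blast
    qed
  next
    assume Y: ?Y
    show ?X
    proof (intro ballI impI)
      fix x y
      assume "x \<in> N" "y \<in> N" and ne: "x \<noteq> y" and cl: "join x y \<in> {x, y}"
      obtain i j where x: "i \<in> {1..r}" "j \<in> {1..s}" "x = J i j"
        using J \<open>x \<in> N\<close> by (rule generating_matrix_obtain)
      obtain k l where y: "k \<in> {1..r}" "l \<in> {1..s}" "y = J k l"
        using J \<open>y \<in> N\<close> by (rule generating_matrix_obtain)
      \<comment> \<open>One order of the join is enough, since sharing a line is a symmetric
        relation.\<close>
      have "i = k \<or> j = l" "(i, j) \<noteq> (k, l)"
        using cl ne generating_matrix_pair_closed_iff[OF J x(1,2) y(1,2)] x(3) y(3) by auto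
      then show "fst (c x) \<noteq> fst (c y) \<and> snd (c x) \<noteq> snd (c y)"
        using Y x y by blast
    qed
  qed
  also have "\<dots> \<longleftrightarrow>
    line_injective r s (\<lambda>i j. fst (c (J i j))) \<and> line_injective r s (\<lambda>i j. snd (c (J i j)))"
    by (simp only: line_injective_iff ball_conj_distrib imp_conjR)
  finally show ?thesis .
qed

section \<open>Latin squares and injectivity along lines\<close>

lemma latin_square_imp_line_injective:
  assumes "latin_square m L"
  shows "line_injective m m L"
  using assms unfolding latin_square_def line_injective_def inj_on_def by metis

text \<open>A line has as many cells as there are symbols, so by finiteness injectivity along it
  gives surjectivity, and every symbol occurs exactly once.\<close>

lemma line_injective_imp_latin_square:
  assumes "line_injective m m L"
    and range: "\<And>i j. i \<in> {1..m} \<Longrightarrow> j \<in> {1..m} \<Longrightarrow> L i j \<in> {1..m}"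
  shows "latin_square m L"
proof -
  have ex1: "\<exists>!i. i \<in> {1..m} \<and> f i = x"
    if "inj_on f {1..m}" "f ` {1..m} \<subseteq> {1..m}" "x \<in> {1..m}" for f :: "nat \<Rightarrow> nat" and x
  proof -
    have "f ` {1..m} = {1..m}"
      using that by (intro endo_inj_surj) auto
    then obtain i where "i \<in> {1..m}" "x = f i"
      using \<open>x \<in> {1..m}\<close> by blast
    then show ?thesis
      using that(1) by (intro ex1I[of _ i]) (auto simp: inj_on_eq_iff)
  qed
  show ?thesis
    unfolding latin_square_def
  proof (intro exI[of _ "{1..m}"] conjI ballI)
    fix x i
    assume "x \<in> {1..m}" "i \<in> {1..m}"
    then show "\<exists>!j. j \<in> {1..m} \<and> L i j = x"
      using assms by (intro ex1) (auto simp: line_injective_def)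
  next
    fix x j
    assume "x \<in> {1..m}" "j \<in> {1..m}"
    then show "\<exists>!i. i \<in> {1..m} \<and> L i j = x"
      using assms by (intro ex1) (auto simp: line_injective_def)
  qed (use range in auto)
qed

text \<open>The first row and the first column, which exist because \<open>r\<close> and
  \<open>s\<close> are positive, inject into the \<open>n\<close> symbols.\<close>

lemma line_injective_le:
  assumes "line_injective r s L" "1 \<le> r" "1 \<le> s"
    and "\<And>i j. i \<in> {1..r} \<Longrightarrow> j \<in> {1..s} \<Longrightarrow> L i j \<in> {1..n::nat}"
  shows "r \<le> n" "s \<le> n"
proof -
  have "inj_on (L 1) {1..s}" "inj_on (\<lambda>i. L i 1) {1..r}"
    using assms by (auto simp: line_injective_def)
  moreover have "L 1 ` {1..s} \<subseteq> {1..n}" "(\<lambda>i. L i 1) ` {1..r} \<subseteq> {1..n}"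
    using assms by force+
  ultimately show "r \<le> n" "s \<le> n"
    using card_inj_on_le[of "L 1" "{1..s}" "{1..n}"]
      card_inj_on_le[of "\<lambda>i. L i 1" "{1..r}" "{1..n}"] by simp_all
qed

section \<open>Labellings in normal form\<close>

lemma label_bij_betw:
  fixes p q :: nat
  shows "bij_betw (\<lambda>(i, j). (i - 1) * q + j) ({1..p} \<times> {1..q}) {1..p * q}"
proof -
  have inj: "inj_on (\<lambda>(i, j). (i - 1) * q + j) ({1..p} \<times> {1..q})"
  proof (rule inj_on_inverseI[where g = "pair_of_label q"])
    fix u
    assume "u \<in> {1..p} \<times> {1..q}"
    then show "pair_of_label q ((\<lambda>(i, j). (i - 1) * q + j) u) = u"
      by (auto intro!: pair_of_label_normal_form simp del: One_nat_def)
  qed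
  \<comment> \<open>Surjectivity comes from counting: the image lies in \<open>{1..p * q}\<close>
    and by injectivity has \<open>p * q\<close> elements.\<close>
  moreover have "(\<lambda>(i, j). (i - 1) * q + j) ` ({1..p} \<times> {1..q}) = {1..p * q}"
  proof (rule card_subset_eq)
    show "(\<lambda>(i, j). (i - 1) * q + j) ` ({1..p} \<times> {1..q}) \<subseteq> {1..p * q}"
    proof (rule image_subsetI)
      fix u
      assume "u \<in> {1..p} \<times> {1..q}"
      then obtain i j where u: "u = (i, j)" and *: "1 \<le> i" "i \<le> p" "1 \<le> j" "j \<le> q"
        by auto
      \<comment> \<open>Labels in row \<open>i\<close> are at most \<open>i * q\<close>, the label
        of its last cell.\<close>
      have "(i - 1) * q + j \<le> (i - 1) * q + q"
        using * by simp
      also have "\<dots> = i * q"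
        using * by (cases i) auto
      also have "\<dots> \<le> p * q"
        using * by simp
      finally show "(\<lambda>(i, j). (i - 1) * q + j) u \<in> {1..p * q}"
        using * by (simp add: u)
    qed
    show "card ((\<lambda>(i, j). (i - 1) * q + j) ` ({1..p} \<times> {1..q})) = card {1..p * q}"
      using card_image[OF inj] by simp
  qed simp
  ultimately show ?thesis
    by (simp add: bij_betw_def)
qed

lemma exists_normalizing_labelling:
  assumes "generating_matrix B f p q G"
  shows "\<exists>\<phi>. bij_betw \<phi> B {1..p * q} \<and> normal_form p q (\<lambda>i j. \<phi> (G i j))"
proof -
  define D where "D = {1..p} \<times> {1..q}"
  have G: "bij_betw (\<lambda>(i, j). G i j) D B"
    using assms by (simp add: generating_matrix_def D_def)
  \<comment> \<open>An element is sent to its cell in \<open>G\<close>, and the cell to its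
    row-by-row number.\<close>
  define \<phi> where "\<phi> = (\<lambda>(i, j). (i - 1) * q + j) \<circ> inv_into D (\<lambda>(i, j). G i j)"
  have "bij_betw \<phi> B {1..p * q}"
    unfolding \<phi>_def using bij_betw_inv_into[OF G] label_bij_betw[of q p, folded D_def]
    by (rule bij_betw_trans)
  moreover have "\<phi> (G i j) = (i - 1) * q + j" if "i \<in> {1..p}" "j \<in> {1..q}" for i j
    using bij_betw_inv_into_left[OF G, of "(i, j)"] that by (simp add: \<phi>_def D_def)
  ultimately show ?thesis
    by (auto simp: normal_form_def)
qed

lemma pair_of_label_normal_form_matrix:
  assumes "normal_form p q L" "i \<in> {1..p}" "j \<in> {1..q}"
  shows "pair_of_label q (L i j) = (i, j)"
  using assms pair_of_label_normal_form by (auto simp: normal_form_def)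

section \<open>Equality of dimensions and the equivalence\<close>

lemma dimensions_eq:
  fixes p q r s :: nat
  assumes pq: "p * q = r * s" and "r \<le> p" "s \<le> p" "r \<le> q" "s \<le> q" "1 \<le> r" "1 \<le> s"
  shows "p = s" "q = s" "r = s"
proof -
  have eq: "a = b \<and> c = d" if "a * c = b * d" "b \<le> a" "d \<le> c" "1 \<le> b" "1 \<le> d" for a b c d :: nat
  proof (rule ccontr)
    assume "\<not> (a = b \<and> c = d)"
    then have "b < a \<or> d < c"
      using that(2,3) by linarith
    then have "b * d < a * c"
      using that(2-5) by (auto intro: mult_less_le_imp_less mult_le_less_imp_less)
    then show False
      using that(1) by simp
  qed
  \<comment> \<open>The same comparison of factors is made twice, pairing \<open>p, q\<close> first
    with \<open>r, s\<close> and then with \<open>s, r\<close>; the two results together identify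
    all four numbers.\<close>
  have "p = r \<and> q = s"
    using assms by (intro eq)
  moreover have "p = s \<and> q = r"
    by (rule eq[OF trans[OF pq mult.commute]]) fact+
  ultimately show "p = s" "q = s" "r = s"
    by linarith+
qed

theorem theorem7p5:
  fixes N :: "'a set" and meet join :: "'a \<Rightarrow> 'a \<Rightarrow> 'a"
  assumes "antilattice N meet join" and "finite N"
  shows "odd_antilattice N meet join \<longleftrightarrow> latin_antilattice N meet join"
proof
  interpret antilattice N meet join
    by (rule assms(1))
  assume odd: "odd_antilattice N meet join"
  obtain p q M where M: "generating_matrix N meet p q M"
    using meet.exists_generating_matrix[OF assms(2)] by blast
  obtain r s J where J: "generating_matrix N join r s J"
    using join.exists_generating_matrix[OF assms(2)] by blast
  obtain \<phi> where \<phi>: "bij_betw \<phi> N {1..p * q}" "normal_form p q (\<lambda>i j. \<phi> (M i j))"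
    using exists_normalizing_labelling[OF M] by blast
  define c where "c x = pair_of_label q (\<phi> x)" for x
  have c: "c (M i j) = (i, j)" if "i \<in> {1..p}" "j \<in> {1..q}" for i j
    using pair_of_label_normal_form_matrix[OF \<phi>(2) that] by (simp add: c_def)
  \<comment> \<open>Every element is an entry of \<open>M\<close>, so \<open>c\<close> is a
    two-sided inverse of reading off entries of \<open>M\<close>.\<close>
  have inv: "fst (c x) \<in> {1..p} \<and> snd (c x) \<in> {1..q} \<and> M (fst (c x)) (snd (c x)) = x"
    if "x \<in> N" for x
    using M that by (rule generating_matrix_obtain) (simp add: c)
  have inj: "line_injective r s (\<lambda>i j. fst (c (J i j)))" "line_injective r s (\<lambda>i j. snd (c (J i j)))"
    using odd odd_antilattice_iff_line_injective[OF assms(1) M J c] by blast+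
  have range: "fst (c (J i j)) \<in> {1..p}" "snd (c (J i j)) \<in> {1..q}"
    if "i \<in> {1..r}" "j \<in> {1..s}" for i j
    using inv generating_matrix_entry[OF J that] by blast+
  have pos: "1 \<le> r" "1 \<le> s"
    using J by (auto simp: generating_matrix_def)
  have "p * q = r * s"
    using generating_matrix_card[OF M] generating_matrix_card[OF J] by simp
  \<comment> \<open>The row coordinates bound \<open>r\<close> and \<open>s\<close> by
    \<open>p\<close>, and the column coordinates bound them by \<open>q\<close>.\<close>
  then have dims: "p = s" "q = s" "r = s"
    using line_injective_le[OF inj(1) pos range(1)] line_injective_le[OF inj(2) pos range(2)] pos
    by (auto dest: dimensions_eq)
  have "latin_square s (\<lambda>i j. fst (c (J i j)))" "latin_square s (\<lambda>i j. snd (c (J i j)))"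
    using inj range unfolding dims by (auto intro!: line_injective_imp_latin_square)
  \<comment> \<open>Orthogonality: the two coordinates determine the element through
    \<open>M\<close>, and each element occupies only one cell of \<open>J\<close>.\<close>
  moreover have "inj_on (\<lambda>(i, j). (fst (c (J i j)), snd (c (J i j)))) ({1..s} \<times> {1..s})"
  proof (rule inj_onI, clarify)
    fix i j k l
    assume ij: "i \<in> {1..s}" "j \<in> {1..s}" and kl: "k \<in> {1..s}" "l \<in> {1..s}"
      and "fst (c (J i j)) = fst (c (J k l))" "snd (c (J i j)) = snd (c (J k l))"
    then have "J i j = J k l"
      using inv generating_matrix_entry[OF J] dims by metis
    then show "i = k \<and> j = l"
      using generating_matrix_eq_iff[OF J] ij kl dims by simp
  qed
  ultimately have "orthogonal_latin_squares r (\<lambda>i j. fst (c (J i j))) (\<lambda>i j. snd (c (J i j)))"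
    by (simp add: orthogonal_latin_squares_def dims)
  then show "latin_antilattice N meet join"
    unfolding latin_antilattice_def c_def using M J \<phi> dims(3) by blast
next
  assume "latin_antilattice N meet join"
  then obtain p q M r J \<phi> where M: "generating_matrix N meet p q M"
    and J: "generating_matrix N join r r J"
    and nf: "normal_form p q (\<lambda>i j. \<phi> (M i j))"
    and orth: "orthogonal_latin_squares r
          (\<lambda>i j. fst (pair_of_label q (\<phi> (J i j))))
          (\<lambda>i j. snd (pair_of_label q (\<phi> (J i j))))"
    unfolding latin_antilattice_def by blast
  have "line_injective r r (\<lambda>i j. fst (pair_of_label q (\<phi> (J i j))))"
    "line_injective r r (\<lambda>i j. snd (pair_of_label q (\<phi> (J i j))))"
    using orth by (auto simp only: orthogonal_latin_squares_def intro: latin_square_imp_line_injective)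
  \<comment> \<open>Normal form makes \<open>pair_of_label q (\<phi> x)\<close> the position of
    \<open>x\<close> in \<open>M\<close>, so it can serve as the coordinate map
    \<open>c\<close>.\<close>
  then show "odd_antilattice N meet join"
    using odd_antilattice_iff_line_injective[OF assms(1) M J,
        where c = "\<lambda>x. pair_of_label q (\<phi> x)", OF pair_of_label_normal_form_matrix[OF nf]]
    by blast
qed

end
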